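(* For every integer $r\geq 1$, the relations $\leq_{\rm box}$ and $\leq_{\rm dom}$ on the set $\mathcal{T}_r$ of all standard Young tableaux with $r$ cells (of arbitrary shape $\alpha$ with $|\alpha|=r$) coincide; that is, for all $\Pi,\Sigma\in\mathcal{T}_r$, $\Pi\leq_{\rm box}\Sigma$ if and only if $\Pi\leq_{\rm dom}\Sigma$.
   Context: A partition $\alpha=(\alpha_1,\ldots,\alpha_s)$ is a finite weakly decreasing sequence of natural numbers, $|\alpha|=\alpha_1+\cdots+\alpha_s$, and $\overline{\alpha}$ is the transposed partition, $\overline{\alpha}_j=\#\{i:\alpha_i\geq j\}$. The Young diagram of $\alpha$ consists of top-aligned columns with $\alpha_1,\ldots,\alpha_s$ cells, so its rows, numbered from the top down, have lengths $\overline{\alpha}_1,\overline{\alpha}_2,\ldots$. For partitions $\alpha,\beta$ write $\alpha\leq_{\rm nat}\beta$ if $\sum_{i=1}^c\overline{\alpha}_i\leq\sum_{i=1}^c\overline{\beta}_i$ for all $c$ (missing parts are $0$). A standard Young tableau (SYT) of shape $\alpha$ is the Young diagram of $\alpha$ filled with the numbers $1,\ldots,|\alpha|$, each used once, strictly increasing along rows and down columns. $\mathcal{T}_\alpha$ is the set of SYTs of shape $\alpha$, and $\mathcal{T}_r=\bigcup_{\alpha:|\alpha|=r}\mathcal{T}_\alpha$. A tableau $\Sigma\in\mathcal{T}_r$ is identified with the sequence of partitions $[\sigma^{(1)},\ldots,\sigma^{(r)}]$, where $\sigma^{(e)}$ is the shape formed by the cells with entries at most $e$. Dominance order: for $\Pi=[\pi^{(1)},\ldots,\pi^{(r)}]$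 and $\Sigma=[\sigma^{(1)},\ldots,\sigma^{(r)}]$ in $\mathcal{T}_r$ (not necessarily of the same shape), $\Pi\leq_{\rm dom}\Sigma$ means $\pi^{(i)}\leq_{\rm nat}\sigma^{(i)}$ for all $i=1,\ldots,r$. Box order: for $\Sigma,\Pi\in\mathcal{T}_r$, $\Pi$ is obtained from $\Sigma$ by a decreasing box move if either $\Pi$ is obtained by swapping two entries in $\Sigma$ so that the smaller entry winds up in the higher-numbered row, or $\Pi$ is obtained by moving the last box of a row of $\Sigma$ (with its entry) to the last position of a higher-numbered row (possibly a previously empty row). In both cases the result $\Pi$ is required to be an SYT. $\leq_{\rm box}$ is the partial order generated by these moves: $\Pi\leq_{\rm box}\Sigma$ iff $\Pi$ is obtained from $\Sigma$ by a finite (possibly empty) sequence of decreasing box moves within $\mathcal{T}_r$. *)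

theory Defs
  imports Main
begin

section \<open>Partitions and Young diagrams\<close>

text \<open>
  Parts are positive, so that a diagram determines its partition. The entries of a partition are
  the lengths of the \<^emph>\<open>columns\<close> of its diagram. Cells are pairs (row, column), both
  numbered from 0, while the parts of the transposed partition are numbered from 1.
\<close>

definition is_partition :: "nat list \<Rightarrow> bool" where
  "is_partition \<alpha> \<longleftrightarrow> sorted_wrt (\<ge>) \<alpha> \<and> 0 \<notin> set \<alpha>"

definition transposed_part :: "nat list \<Rightarrow> nat \<Rightarrow> nat" where
  "transposed_part \<alpha> j = card {i. i < length \<alpha> \<and> \<alpha> ! i \<ge> j}"

definition nat_le :: "nat list \<Rightarrow> nat list \<Rightarrow> bool" where
  "nat_le \<alpha> \<beta> \<longleftrightarrow>
     (\<forall>c. (\<Sum>i=1..c. transposed_part \<alpha> i) \<le> (\<Sum>i=1..c. transposed_part \<beta> i))"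

type_synonym cell = "nat \<times> nat"

definition young_diagram :: "nat list \<Rightarrow> cell set" where
  "young_diagram \<alpha> = {(i, j). j < length \<alpha> \<and> i < \<alpha> ! j}"

lemma card_row_young_diagram:
  "card {j. (i, j) \<in> young_diagram \<alpha>} = transposed_part \<alpha> (Suc i)"
  by (simp add: young_diagram_def transposed_part_def Suc_le_eq)

lemma young_diagram_inj:
  assumes "is_partition \<alpha>" "is_partition \<beta>" "young_diagram \<alpha> = young_diagram \<beta>"
  shows "\<alpha> = \<beta>"
proof -
  have pos: "0 < \<gamma> ! j" if "is_partition \<gamma>" "j < length \<gamma>" for \<gamma> j
    using that unfolding is_partition_def by (metis gr0I nth_mem)
  have mem: "(i, j) \<in> young_diagram \<gamma> \<longleftrightarrow> j < length \<gamma> \<and> i < \<gamma> ! j" for \<gamma> i j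
    by (simp add: young_diagram_def)
  have "j < length \<alpha> \<longleftrightarrow> j < length \<beta>" for j
    using pos[OF assms(1), of j] pos[OF assms(2), of j] mem[of 0 j \<alpha>] mem[of 0 j \<beta>]
    unfolding assms(3) by blast
  then have "{..<length \<alpha>} = {..<length \<beta>}" by (simp add: lessThan_def)
  then have len: "length \<alpha> = length \<beta>" by simp
  have "\<alpha> ! j = \<beta> ! j" if "j < length \<alpha>" for j
  proof -
    have "i < \<alpha> ! j \<longleftrightarrow> i < \<beta> ! j" for i
      using mem[of i j \<alpha>] mem[of i j \<beta>] that unfolding len assms(3) by blast
    then have "{..<\<alpha> ! j} = {..<\<beta> ! j}" by (simp add: lessThan_def)
    then show ?thesis by simp
  qed
  with len show ?thesis
    by (simp add: nth_equalityI)
qed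


section \<open>Standard Young tableaux\<close>

text \<open>A tableau is a partial map whose domain is the diagram.\<close>

type_synonym tableau = "cell \<rightharpoonup> nat"

definition is_SYT :: "nat list \<Rightarrow> tableau \<Rightarrow> bool" where
  "is_SYT \<alpha> T \<longleftrightarrow>
     dom T = young_diagram \<alpha> \<and>
     bij_betw (\<lambda>p. the (T p)) (young_diagram \<alpha>) {1..sum_list \<alpha>} \<and>
     (\<forall>i j j'. j < j' \<and> (i, j) \<in> dom T \<and> (i, j') \<in> dom T \<longrightarrow> the (T (i, j)) < the (T (i, j'))) \<and>
     (\<forall>i i' j. i < i' \<and> (i, j) \<in> dom T \<and> (i', j) \<in> dom T \<longrightarrow> the (T (i, j)) < the (T (i', j)))"

definition SYT_of :: "nat list \<Rightarrow> tableau set" where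
  "SYT_of \<alpha> = {T. is_SYT \<alpha> T}"

definition SYTs :: "nat \<Rightarrow> tableau set" where
  "SYTs r = (\<Union>\<alpha>\<in>{\<alpha>. is_partition \<alpha> \<and> sum_list \<alpha> = r}. SYT_of \<alpha>)"

definition cells_upto :: "tableau \<Rightarrow> nat \<Rightarrow> cell set" where
  "cells_upto T e = {p \<in> dom T. the (T p) \<le> e}"

definition subshape :: "tableau \<Rightarrow> nat \<Rightarrow> nat list" where
  "subshape T e = (THE \<sigma>. is_partition \<sigma> \<and> young_diagram \<sigma> = cells_upto T e)"

text \<open>The definite description above is well defined on tableaux.\<close>

lemma down_set_is_young_diagram:
  assumes fin: "finite D"
    and down: "\<And>i j i' j'. (i, j) \<in> D \<Longrightarrow> i' \<le> i \<Longrightarrow> j' \<le> j \<Longrightarrow> (i', j') \<in> D"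
  shows "\<exists>\<sigma>. is_partition \<sigma> \<and> young_diagram \<sigma> = D"
proof -
  have initial: "x \<in> A \<longleftrightarrow> x < card A"
    if "finite A" "\<And>x y. x \<in> A \<Longrightarrow> y \<le> x \<Longrightarrow> y \<in> A" for A :: "nat set" and x
  proof
    assume "x \<in> A"
    then have "{..x} \<subseteq> A" using that(2) by auto
    from card_mono[OF that(1) this] show "x < card A" by simp
  next
    assume "x < card A"
    show "x \<in> A"
    proof (rule ccontr)
      assume "x \<notin> A"
      then have "A \<subseteq> {..<x}" using that(2) by (auto simp: not_le[symmetric])
      from card_mono[OF _ this] \<open>x < card A\<close> show False by simp
    qed
  qed
  define col where "col j = card {i. (i, j) \<in> D}" for j
  define n where "n = card {j. (0, j) \<in> D}"
  define \<sigma> where "\<sigma> = map col [0..<n]"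
  have fcol: "finite {i. (i, j) \<in> D}" for j
    by (rule finite_subset[OF _ finite_imageI[OF fin, of fst]]) force
  have frow: "finite {j. (0, j) \<in> D}"
    by (rule finite_subset[OF _ finite_imageI[OF fin, of snd]]) force
  have col: "(i, j) \<in> D \<longleftrightarrow> i < col j" for i j
    using initial[OF fcol, of j i] down[of _ j _ j] unfolding col_def by auto
  have row: "(0, j) \<in> D \<longleftrightarrow> j < n" for j
    using initial[OF frow, of j] down[of 0 _ 0] unfolding n_def by auto
  have "is_partition \<sigma>"
    unfolding is_partition_def
  proof
    show "sorted_wrt (\<ge>) \<sigma>"
      unfolding sorted_wrt_iff_nth_less
    proof (intro allI impI)
      fix i j assume "i < j" "j < length \<sigma>"
      have "col j \<le> col i"
        unfolding col_def
        by (rule card_mono[OF fcol]) (use down \<open>i < j\<close> in \<open>auto intro: less_imp_le\<close>)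
      then show "\<sigma> ! j \<le> \<sigma> ! i"
        using \<open>i < j\<close> \<open>j < length \<sigma>\<close> by (simp add: \<sigma>_def)
    qed
    show "0 \<notin> set \<sigma>"
      using col[of 0] row by (auto simp: \<sigma>_def)
  qed
  moreover have "young_diagram \<sigma> = D"
  proof -
    have "(i, j) \<in> young_diagram \<sigma> \<longleftrightarrow> (i, j) \<in> D" for i j
      using col[of i j] row[of j] down[of i j 0 j] by (auto simp: young_diagram_def \<sigma>_def)
    then show ?thesis by auto
  qed
  ultimately show ?thesis by blast
qed

lemma finite_young_diagram: "finite (young_diagram \<alpha>)"
proof -
  have "young_diagram \<alpha> \<subseteq> (\<Union>j<length \<alpha>. {..<\<alpha> ! j} \<times> {j})"
    by (auto simp: young_diagram_def)
  then show ?thesis by (rule finite_subset) simp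
qed

lemma young_diagram_down:
  assumes "is_partition \<alpha>" "(i, j) \<in> young_diagram \<alpha>" "i' \<le> i" "j' \<le> j"
  shows "(i', j') \<in> young_diagram \<alpha>"
proof -
  have "\<alpha> ! j \<le> \<alpha> ! j'" if "j' < j"
    using assms that unfolding is_partition_def sorted_wrt_iff_nth_less
    by (simp add: young_diagram_def)
  then show ?thesis
    using assms(2-4) by (cases "j' = j") (auto simp: young_diagram_def)
qed

lemma subshape:
  assumes "T \<in> SYTs r"
  shows "is_partition (subshape T e)" "young_diagram (subshape T e) = cells_upto T e"
proof -
  from assms obtain \<alpha> where \<alpha>: "is_partition \<alpha>" "is_SYT \<alpha> T"
    by (auto simp: SYTs_def SYT_of_def)
  have dom: "dom T = young_diagram \<alpha>"
    and incr_row: "\<And>i j j'. j < j' \<Longrightarrow> (i, j) \<in> dom T \<Longrightarrow> (i, j') \<in> dom T \<Longrightarrow>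
      the (T (i, j)) < the (T (i, j'))"
    and incr_col: "\<And>i i' j. i < i' \<Longrightarrow> (i, j) \<in> dom T \<Longrightarrow> (i', j) \<in> dom T \<Longrightarrow>
      the (T (i, j)) < the (T (i', j))"
    using \<alpha>(2) unfolding is_SYT_def by blast+
  have "finite (cells_upto T e)"
    using finite_young_diagram[of \<alpha>] by (auto simp: cells_upto_def dom[symmetric])
  moreover have "(i', j') \<in> cells_upto T e"
    if "(i, j) \<in> cells_upto T e" "i' \<le> i" "j' \<le> j" for i j i' j'
  proof -
    have d: "(i, j) \<in> dom T" "the (T (i, j)) \<le> e"
      using that(1) unfolding cells_upto_def by auto
    have d': "(i, j') \<in> dom T" "(i', j') \<in> dom T"
      using d(1) that young_diagram_down[OF \<alpha>(1)] unfolding dom by blast+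
    have "the (T (i', j')) \<le> the (T (i, j'))"
      using incr_col[OF _ d'(2,1)] that(2) by (cases "i' = i") (auto intro: less_imp_le)
    also have "\<dots> \<le> the (T (i, j))"
      using incr_row[OF _ d'(1) d(1)] that(3) by (cases "j' = j") (auto intro: less_imp_le)
    finally show ?thesis using d d' unfolding cells_upto_def by auto
  qed
  ultimately have "\<exists>\<sigma>. is_partition \<sigma> \<and> young_diagram \<sigma> = cells_upto T e"
    by (rule down_set_is_young_diagram)
  then have "\<exists>!\<sigma>. is_partition \<sigma> \<and> young_diagram \<sigma> = cells_upto T e"
    using young_diagram_inj by metis
  from theI'[OF this]
  show "is_partition (subshape T e)" "young_diagram (subshape T e) = cells_upto T e"
    unfolding subshape_def by auto
qed


section \<open>Dominance order and box order\<close>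

definition dom_le :: "nat \<Rightarrow> tableau \<Rightarrow> tableau \<Rightarrow> bool" where
  "dom_le r P S \<longleftrightarrow> (\<forall>i\<in>{1..r}. nat_le (subshape P i) (subshape S i))"

text \<open>
  The moves lead from \<open>S\<close> to \<open>P\<close>. That the result is again a standard Young tableau is
  required in \<open>box_move\<close> below.
\<close>

definition swap_move :: "tableau \<Rightarrow> tableau \<Rightarrow> bool" where
  "swap_move S P \<longleftrightarrow>
     (\<exists>i j k l a b. S (i, j) = Some a \<and> S (k, l) = Some b \<and> a < b \<and> i < k \<and>
        P = S((i, j) \<mapsto> b, (k, l) \<mapsto> a))"

definition row_length :: "tableau \<Rightarrow> nat \<Rightarrow> nat" where
  "row_length T i = card {j. (i, j) \<in> dom T}"

definition shift_move :: "tableau \<Rightarrow> tableau \<Rightarrow> bool" where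
  "shift_move S P \<longleftrightarrow>
     (\<exists>i k. 0 < row_length S i \<and> i < k \<and>
        P = S((i, row_length S i - 1) := None,
              (k, row_length S k) := S (i, row_length S i - 1)))"

definition box_move :: "nat \<Rightarrow> tableau \<Rightarrow> tableau \<Rightarrow> bool" where
  "box_move r S P \<longleftrightarrow> S \<in> SYTs r \<and> P \<in> SYTs r \<and> (swap_move S P \<or> shift_move S P)"

definition box_le :: "nat \<Rightarrow> tableau \<Rightarrow> tableau \<Rightarrow> bool" where
  "box_le r P S \<longleftrightarrow> (box_move r)\<^sup>*\<^sup>* S P"

end

theory Submission
  imports Defs
begin

text \<open>
  Record a standard tableau with \<open>r\<close> cells by the word \<open>w\<close> whose letter \<open>w x\<close> is the row of the
  entry \<open>Suc x\<close>. Standard tableaux correspond to lattice words in this way, and \<open>P\<close> lies below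
  \<open>S\<close> in dominance order iff, for all \<open>e\<close> and \<open>c\<close>, at most as many entries \<open>\<le> e\<close> lie in the first
  \<open>c\<close> rows of \<open>P\<close> as in those of \<open>S\<close> (\<open>dom_le_iff_word_le\<close>). A box move replaces letters
  \<open>i < k\<close> at positions \<open>a < b\<close> by \<open>k\<close> and \<open>i\<close>; moving the last box of a row is the case where
  \<open>b\<close> is the position \<open>r\<close> just behind the word. Such an exchange lowers the counts by one exactly
  for \<open>a < e \<le> b\<close>, \<open>i < c \<le> k\<close> (\<open>top_count_exchange\<close>). Thus the box order is contained in the
  dominance order.

  Conversely, let \<open>v\<close> and \<open>w\<close> be the words of tableaux \<open>P \<noteq> S\<close> with \<open>P\<close> below \<open>S\<close>. It suffices
  to find one exchange in \<open>w\<close> that gives a lattice word still above \<open>v\<close>, since the counts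
  decrease and cannot do so forever. Let \<open>D e c \<ge> 0\<close> be the difference of the counts of \<open>w\<close> and
  \<open>v\<close>. The predicate \<open>movable\<close> says that the entry at position \<open>a\<close> may be held in row \<open>k\<close>
  instead of its own row from time \<open>a + 1\<close> up to time \<open>e\<close>: the shapes remain partitions and \<open>D\<close>
  is positive where it has to drop. If the next letter \<open>w e\<close> is \<open>k\<close>, or if \<open>e = r\<close>, this yields
  a box move.

  The heart of the proof (\<open>movable_exists\<close>) is that as long as no swap has become possible, every
  row \<open>k\<close> which looks like a sensible target at time \<open>e\<close> does have a movable entry: it suffices
  that \<open>k\<close> can receive a box, that \<open>D e\<close> vanishes at some \<open>l < k\<close> and is positive at
  \<open>l + 1, \<dots>, k\<close>, and that row \<open>l\<close> is longer than row \<open>k\<close> by at least two. Consider now the last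
  time at which \<open>D\<close> does not vanish. Rows of \<open>P\<close> have weakly decreasing lengths, so a maximal
  interval on which \<open>D\<close> is positive forces \<open>S\<close> to have a drop of two between the rows at its ends
  (\<open>row_gap_of_interval\<close>), and the claim supplies a movable entry. If the time is \<open>r\<close>, the entry
  can be shifted; otherwise the next letter of \<open>w\<close> is the target row, and a swap is possible.
\<close>

section \<open>Lattice words\<close>

text \<open>
  Letters are numbered from 0, so that the prefix of length \<open>e\<close> describes the entries \<open>1, \<dots>, e\<close>:
  \<open>row_count w e i\<close> is the length of row \<open>i\<close> of the shape that they form, and \<open>top_count w e c\<close>
  is the number of its cells in the first \<open>c\<close> rows. Only the letters at positions below \<open>r\<close>
  matter for a tableau with \<open>r\<close> cells.
\<close>

definition row_count :: "(nat \<Rightarrow> nat) \<Rightarrow> nat \<Rightarrow> nat \<Rightarrow> nat" where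
  "row_count w e i = card {x. x < e \<and> w x = i}"

definition top_count :: "(nat \<Rightarrow> nat) \<Rightarrow> nat \<Rightarrow> nat \<Rightarrow> nat" where
  "top_count w e c = card {x. x < e \<and> w x < c}"

definition lattice_word :: "nat \<Rightarrow> (nat \<Rightarrow> nat) \<Rightarrow> bool" where
  "lattice_word r w \<longleftrightarrow> (\<forall>e\<le>r. \<forall>i. row_count w e (Suc i) \<le> row_count w e i)"

definition word_le :: "nat \<Rightarrow> (nat \<Rightarrow> nat) \<Rightarrow> (nat \<Rightarrow> nat) \<Rightarrow> bool" where
  "word_le r v w \<longleftrightarrow> (\<forall>e\<le>r. \<forall>c. top_count v e c \<le> top_count w e c)"

lemma card_prefix_Suc:
  "card {x. x < Suc e \<and> Q x} = card {x. x < e \<and> Q x} + of_bool (Q e)"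
proof -
  have "{x. x < Suc e \<and> Q x} = {x. x < e \<and> Q x} \<union> (if Q e then {e} else {})"
    by (auto simp: less_Suc_eq)
  then show ?thesis by simp
qed

lemma row_count_0 [simp]: "row_count w 0 i = 0"
  by (simp add: row_count_def)

lemma top_count_0 [simp]: "top_count w 0 c = 0"
  by (simp add: top_count_def)

lemma top_count_no_rows [simp]: "top_count w e 0 = 0"
  by (simp add: top_count_def)

lemma row_count_Suc: "row_count w (Suc e) i = row_count w e i + of_bool (w e = i)"
  unfolding row_count_def by (rule card_prefix_Suc)

lemma top_count_Suc: "top_count w (Suc e) c = top_count w e c + of_bool (w e < c)"
  unfolding top_count_def by (rule card_prefix_Suc)

lemma top_count_cong:
  assumes "\<And>x. x < r \<Longrightarrow> v x = w x" "e \<le> r"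
  shows "top_count v e c = top_count w e c"
proof -
  have "{x. x < e \<and> v x < c} = {x. x < e \<and> w x < c}" using assms by auto
  then show ?thesis by (simp add: top_count_def)
qed

lemma top_count_Suc_row: "top_count w e (Suc c) = top_count w e c + row_count w e c"
  by (induction e) (auto simp: row_count_Suc top_count_Suc)

lemma top_count_eq_sum: "top_count w e c = (\<Sum>i<c. row_count w e i)"
  by (induction c) (auto simp: top_count_Suc_row)

lemma row_count_mono: "e \<le> e' \<Longrightarrow> row_count w e i \<le> row_count w e' i"
  unfolding row_count_def by (rule card_mono) auto

lemma row_count_less:
  assumes "w x = i" "x < y"
  shows "row_count w x i < row_count w y i"
  using row_count_mono[of "Suc x" y w i] assms by (simp add: row_count_Suc)

lemma row_count_inj:
  assumes "w x = i" "w y = i" "row_count w x i = row_count w y i"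
  shows "x = y"
  using row_count_less[of w x i y] row_count_less[of w y i x] assms by (metis less_irrefl nat_neq_iff)

lemma row_count_attained:
  "j < row_count w e i \<Longrightarrow> \<exists>x<e. w x = i \<and> row_count w x i = j"
proof (induction e)
  case (Suc e)
  show ?case
  proof (cases "j < row_count w e i")
    case True
    then show ?thesis using Suc.IH less_SucI by blast
  next
    case False
    then have "w e = i \<and> row_count w e i = j"
      using Suc.prems by (auto simp: row_count_Suc of_bool_def split: if_splits)
    then show ?thesis by blast
  qed
qed simp

lemma lattice_word_antimono:
  assumes "lattice_word r w" "e \<le> r" "i \<le> i'"
  shows "row_count w e i' \<le> row_count w e i"
  using assms(3) by (rule lift_Suc_antimono_le[rotated]) (use assms in \<open>simp add: lattice_word_def\<close>)

lemma lattice_word_addable: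
  assumes "lattice_word r w" "e < r" "0 < w e"
  shows "row_count w e (w e) < row_count w e (w e - 1)"
proof -
  have "row_count w (Suc e) (w e) \<le> row_count w (Suc e) (w e - 1)"
    using lattice_word_antimono[OF assms(1), of "Suc e" "w e - 1" "w e"] assms(2) by simp
  moreover have "w e \<noteq> w e - 1" using assms(3) by simp
  ultimately show ?thesis by (simp add: row_count_Suc)
qed

lemma top_count_le: "top_count w e c \<le> e"
  using card_mono[of "{..<e}" "{x. x < e \<and> w x < c}"] by (auto simp: top_count_def)

text \<open>
  A letter \<open>i\<close> must be preceded by letters \<open>0, \<dots>, i - 1\<close>, since each of these rows is at least
  as long as row \<open>i\<close> afterwards.
\<close>

lemma lattice_word_letter_le:
  assumes "lattice_word r w" "x < r"
  shows "w x \<le> x"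
proof -
  have "1 \<le> row_count w (Suc x) i" if "i \<le> w x" for i
    using lattice_word_antimono[OF assms(1), of "Suc x" i "w x"] assms(2) that
    by (simp add: row_count_Suc)
  then have "(\<Sum>i<Suc (w x). 1) \<le> top_count w (Suc x) (Suc (w x))"
    unfolding top_count_eq_sum by (intro sum_mono) auto
  then show ?thesis using top_count_le[of w "Suc x" "Suc (w x)"] by simp
qed

lemma top_count_all_rows:
  assumes "lattice_word r w" "e \<le> r" "e \<le> c"
  shows "top_count w e c = e"
proof -
  have "w x < c" if "x < e" for x
    using lattice_word_letter_le[OF assms(1), of x] assms that by simp
  then have "{x. x < e \<and> w x < c} = {..<e}" by auto
  then show ?thesis by (simp add: top_count_def)
qed

lemma top_count_determines:
  assumes "\<And>e c. e \<le> r \<Longrightarrow> top_count v e c = top_count w e c" "x < r"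
  shows "v x = w x"
proof -
  have "(v x < c) = (w x < c)" for c
    using assms(1)[of x c] assms(1)[of "Suc x" c] assms(2) by (auto simp: top_count_Suc of_bool_def split: if_splits)
  then show ?thesis by (metis linorder_neqE_nat less_irrefl)
qed

section \<open>Exchanging two letters\<close>

text \<open>
  In the next two lemmas the condition on \<open>e\<close> and \<open>b\<close> treats both kinds of box moves at once. For a
  swap the letter at \<open>b\<close> is \<open>k\<close>; for a shift \<open>b\<close> is the length of the word, and only prefixes of
  length at most \<open>b\<close> are of interest.
\<close>

lemma row_count_exchange:
  assumes "a < b" "w a = i" "e \<le> b \<or> w b = k"
  shows "row_count (w(a := k, b := i)) e j + of_bool (a < e \<and> e \<le> b \<and> j = i)
       = row_count w e j + of_bool (a < e \<and> e \<le> b \<and> j = k)"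
proof -
  define w' where "w' = w(a := k, b := i)"
  have w': "w' a = k" "w' b = i" "\<And>x. x \<noteq> a \<Longrightarrow> x \<noteq> b \<Longrightarrow> w' x = w x"
    using assms(1) by (simp_all add: w'_def)
  have "e \<le> b \<or> w b = k \<Longrightarrow> row_count w' e j + of_bool (a < e \<and> e \<le> b \<and> j = i)
       = row_count w e j + of_bool (a < e \<and> e \<le> b \<and> j = k)"
  proof (induction e)
    case (Suc e)
    then have IH: "row_count w' e j + of_bool (a < e \<and> e \<le> b \<and> j = i)
       = row_count w e j + of_bool (a < e \<and> e \<le> b \<and> j = k)" by auto
    consider "e < a" | "e = a" | "a < e" "e < b" | "e = b" "w b = k" | "b < e"
      using Suc.prems by linarith
    then show ?case
      using IH assms(1,2) by cases (auto simp: row_count_Suc w')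
  qed simp
  then show ?thesis using assms(3) by (simp add: w'_def)
qed

lemma top_count_exchange:
  assumes "a < b" "w a = i" "i < k" "e \<le> b \<or> w b = k"
  shows "top_count (w(a := k, b := i)) e c + of_bool (a < e \<and> e \<le> b \<and> i < c \<and> c \<le> k)
       = top_count w e c"
proof -
  define w' where "w' = w(a := k, b := i)"
  have w': "w' a = k" "w' b = i" "\<And>x. x \<noteq> a \<Longrightarrow> x \<noteq> b \<Longrightarrow> w' x = w x"
    using assms(1) by (simp_all add: w'_def)
  have "e \<le> b \<or> w b = k \<Longrightarrow> top_count w' e c + of_bool (a < e \<and> e \<le> b \<and> i < c \<and> c \<le> k)
       = top_count w e c"
  proof (induction e)
    case (Suc e)
    then have IH: "top_count w' e c + of_bool (a < e \<and> e \<le> b \<and> i < c \<and> c \<le> k)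
       = top_count w e c" by auto
    consider "e < a" | "e = a" | "a < e" "e < b" | "e = b" "w b = k" | "b < e"
      using Suc.prems by linarith
    then show ?case
      using IH assms(1-3) by cases (auto simp: top_count_Suc w')
  qed simp
  then show ?thesis using assms(4) by (simp add: w'_def)
qed

lemma row_count_constant:
  assumes "a \<le> e" "\<And>u. a \<le> u \<Longrightarrow> u < e \<Longrightarrow> w u \<noteq> j"
  shows "row_count w e j = row_count w a j"
proof -
  have "{x. x < e \<and> w x = j} = {x. x < a \<and> w x = j}"
    using assms by (auto simp: not_less[symmetric])
  then show ?thesis by (simp add: row_count_def)
qed

text \<open>
  During the exchange, rows \<open>w a, \<dots>, k\<close> do not change between positions \<open>a\<close> and \<open>b\<close>, so there they
  have the lengths from time \<open>a\<close>, except that the new box is in row \<open>k\<close> and not in row \<open>w a\<close>.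
  Hence it is enough that row \<open>k\<close> can receive a box at time \<open>a\<close>. At the ends of the range nothing
  can go wrong: row \<open>w a\<close>, just below row \<open>w a - 1\<close>, only becomes shorter, and row \<open>k\<close>, just above
  row \<open>k + 1\<close>, only becomes longer.
\<close>

lemma exchange_lattice_word:
  assumes "lattice_word r w" "a < b" "b \<le> r" "w a < k" "b < r \<Longrightarrow> w b = k"
    and between: "\<And>u. a < u \<Longrightarrow> u < b \<Longrightarrow> \<not> (w a \<le> w u \<and> w u \<le> k)"
    and addable: "row_count w a k < row_count w a (k - 1)"
  shows "lattice_word r (w(a := k, b := w a))"
  unfolding lattice_word_def
proof (intro allI impI)
  fix e j assume e: "e \<le> r"
  let ?w = "w(a := k, b := w a)"
  have old: "row_count w e (Suc j) \<le> row_count w e j"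
    using assms(1) e by (simp add: lattice_word_def)
  have eb: "e \<le> b \<or> w b = k"
    using assms(3,5) e by (meson le_trans not_le)
  have ex: "row_count ?w e j + of_bool (a < e \<and> e \<le> b \<and> j = w a)
       = row_count w e j + of_bool (a < e \<and> e \<le> b \<and> j = k)" for j
    by (rule row_count_exchange) (use assms eb in auto)
  show "row_count ?w e (Suc j) \<le> row_count ?w e j"
  proof (cases "a < e \<and> e \<le> b")
    case False
    then show ?thesis using ex[of j] ex[of "Suc j"] old by auto
  next
    case True
    show ?thesis
    proof (cases "w a \<le> j \<and> Suc j \<le> k")
      case False
      then show ?thesis using ex[of j] ex[of "Suc j"] old True \<open>w a < k\<close>
        by (auto split: if_splits)
    next
      case inside: True
      have const: "row_count ?w e m = row_count w a m + of_bool (m = k)" if "w a \<le> m" "m \<le> k" for m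
      proof -
        have "row_count w e m = row_count w (Suc a) m"
          by (rule row_count_constant) (use True between that in \<open>auto simp: Suc_le_eq\<close>)
        then show ?thesis using ex[of m] True \<open>w a < k\<close>
          by (auto simp: row_count_Suc of_bool_def split: if_splits)
      qed
      have "row_count w a (Suc j) \<le> row_count w a j"
        using assms(1-3) by (simp add: lattice_word_def)
      then show ?thesis
        using const[of j] const[of "Suc j"] inside addable by auto
    qed
  qed
qed

section \<open>Finding a decreasing exchange\<close>

text \<open>
  No letter from \<open>w a, \<dots>, k\<close> occurs strictly between \<open>a\<close> and \<open>e\<close>. This makes the exchange of \<open>a\<close> with position \<open>e\<close> a
  swap of two entries, or a move of the last box of a row to the end of another one, and reduces
  the condition on the shapes to time \<open>a\<close>, as in \<open>exchange_lattice_word\<close>.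
\<close>

definition movable :: "(nat \<Rightarrow> nat) \<Rightarrow> (nat \<Rightarrow> nat) \<Rightarrow> nat \<Rightarrow> nat \<Rightarrow> nat \<Rightarrow> bool" where
  "movable v w a k e \<longleftrightarrow> a < e \<and> w a < k \<and>
     (\<forall>u. a < u \<and> u < e \<longrightarrow> \<not> (w a \<le> w u \<and> w u \<le> k)) \<and>
     (\<forall>u c. a < u \<and> u \<le> e \<and> w a < c \<and> c \<le> k \<longrightarrow> top_count v u c < top_count w u c) \<and>
     row_count w a k < row_count w a (k - 1)"

lemma movable_start:
  assumes "w e < k" "row_count w e k < row_count w e (k - 1)"
    and "\<And>c. w e < c \<Longrightarrow> c \<le> k \<Longrightarrow> top_count v (Suc e) c < top_count w (Suc e) c"
  shows "movable v w e k (Suc e)"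
  unfolding movable_def using assms by (auto simp: less_Suc_eq le_Suc_eq)

lemma movable_extend:
  assumes "movable v w a k e" "\<not> (w a \<le> w e \<and> w e \<le> k)"
    and "\<And>c. w a < c \<Longrightarrow> c \<le> k \<Longrightarrow> top_count v (Suc e) c < top_count w (Suc e) c"
  shows "movable v w a k (Suc e)"
  using assms unfolding movable_def by (auto simp: less_Suc_eq le_Suc_eq)

lemma last_coincidence_below:
  assumes "top_count v e k < top_count w e k"
  obtains l where "l < k" "top_count w e l \<le> top_count v e l"
    "\<And>c. l < c \<Longrightarrow> c \<le> k \<Longrightarrow> top_count v e c < top_count w e c"
proof -
  let ?Q = "\<lambda>l. l \<le> k \<and> top_count w e l \<le> top_count v e l"
  define l where "l = Greatest ?Q"
  have Q: "?Q l"
    unfolding l_def by (rule GreatestI_nat[of ?Q 0 k]) auto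
  have "c \<le> l" if "?Q c" for c
    unfolding l_def by (rule Greatest_le_nat[of ?Q c k]) (use that in auto)
  then have "top_count v e c < top_count w e c" if "l < c" "c \<le> k" for c
    using that by (meson not_le)
  moreover have "l < k" using Q assms by (cases "l = k") auto
  ultimately show ?thesis using that Q by blast
qed

text \<open>
  The induction follows the letter \<open>w e\<close> that is added to \<open>w\<close>. Three mechanisms keep the claim alive.
  If \<open>w e < k\<close> enters a row below which \<open>D\<close> is positive down to \<open>k\<close>, then the new entry itself is
  movable to \<open>k\<close>. If instead \<open>D\<close> drops to 0 below the row of the movable entry, then \<open>w e > k\<close>, and
  \<open>D\<close> was positive all the way to \<open>w e\<close>; so by the induction hypothesis an entry was movable to row
  \<open>w e\<close>, and a swap was possible. Otherwise the old entry remains movable.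

  The assumption that row \<open>l\<close> exceeds row \<open>k\<close> by two cannot be weakened to one: if \<open>w\<close> puts a box
  into row \<open>k - 1\<close>, and rows \<open>k - 1\<close> and \<open>k\<close> had equal lengths before, then row \<open>k\<close> becomes able to
  receive a box, but not that from row \<open>k - 1\<close>.
\<close>

lemma movable_exists:
  assumes lat: "lattice_word r w" and le: "word_le r v w"
    and stuck: "\<And>e' a. e' < e \<Longrightarrow> \<not> movable v w a (w e') e'"
    and "e \<le> r" "l < k" "top_count w e l \<le> top_count v e l"
    and "\<And>c. l < c \<Longrightarrow> c \<le> k \<Longrightarrow> top_count v e c < top_count w e c"
    and "row_count w e k < row_count w e (k - 1)"
    and "row_count w e k + 2 \<le> row_count w e l"
  shows "\<exists>a. movable v w a k e"
  using assms(3-)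
proof (induction e arbitrary: k l)
  case 0
  then show ?case by simp
next
  case (Suc e)
  \<comment> \<open>Over the integers, the change of the difference in one step is a plain equation.\<close>
  define D where "D e c = int (top_count w e c) - int (top_count v e c)" for e c
  have D_nonneg: "0 \<le> D e' c" if "e' \<le> r" for e' c
    using le that by (simp add: D_def word_le_def)
  have D_Suc: "D (Suc e) c = D e c + of_bool (w e < c) - of_bool (v e < c)" for c
    by (simp add: D_def top_count_Suc)
  have D_iff: "top_count v e' c < top_count w e' c \<longleftrightarrow> 0 < D e' c" for e' c
    by (simp add: D_def)
  have D_iff': "top_count w e' c \<le> top_count v e' c \<longleftrightarrow> D e' c \<le> 0" for e' c
    by (simp add: D_def)
  have anti: "row_count w e j \<le> row_count w e i" if "i \<le> j" for i j
    by (rule lattice_word_antimono[OF lat]) (use Suc.prems that in auto)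
  have IH: "\<exists>a. movable v w a k' e"
    if "l' < k'" "D e l' \<le> 0" "\<And>c. l' < c \<Longrightarrow> c \<le> k' \<Longrightarrow> 0 < D e c"
       "row_count w e k' < row_count w e (k' - 1)" "row_count w e k' + 2 \<le> row_count w e l'" for k' l'
    by (rule Suc.IH[where k = k' and l = l']) (use Suc.prems that D_iff D_iff' in auto)
  have addable_s: "row_count w e (w e) < row_count w e (w e - 1)" if "0 < w e"
    by (rule lattice_word_addable[OF lat]) (use Suc.prems that in auto)
  have no_move: "\<not> movable v w a (w e) e" for a
    using Suc.prems(1) by auto
  note pos = Suc.prems(5)[unfolded D_iff]
  have start: "\<exists>a. movable v w a k (Suc e)"
    if "w e < k" "row_count w e k < row_count w e (k - 1)" "\<And>c. w e < c \<Longrightarrow> c \<le> k \<Longrightarrow> 0 < D (Suc e) c"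
    using movable_start[of w e k v] that D_iff by blast
  have posk: "0 < D (Suc e) k" using pos[of k] Suc.prems(3) by simp
  show ?case
  proof (cases "row_count w e k < row_count w e (k - 1)")
    \<comment> \<open>Row \<open>k\<close> became able to receive a box just now. Then row \<open>k - 1\<close> was a target before, so the
      letter \<open>w e = k - 1\<close> would have completed a swap.\<close>
    case False
    then have s: "w e = k - 1" and eq: "row_count w e (k - 1) = row_count w e k"
      using Suc.prems(6) anti[of "k - 1" k] Suc.prems(3) by (auto simp: row_count_Suc of_bool_def split: if_splits)
    have "l \<noteq> k - 1"
      using Suc.prems(3,7) s eq by (auto simp: row_count_Suc)
    then have l: "l < k - 1" using Suc.prems(3) by simp
    have gap: "row_count w e (k - 1) + 2 \<le> row_count w e l"
      using Suc.prems(3,7) s eq l by (auto simp: row_count_Suc)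
    have pos': "0 < D e (k - 1)"
      using pos[of "k - 1"] l s D_Suc[of "k - 1"] by (auto simp: of_bool_def split: if_splits)
    then obtain l0 where l0: "l0 < k - 1" "D e l0 \<le> 0" "\<And>c. l0 < c \<Longrightarrow> c \<le> k - 1 \<Longrightarrow> 0 < D e c"
      using last_coincidence_below[of v e "k - 1" w] D_iff D_iff' by metis
    have "l0 \<le> l"
    proof (rule ccontr)
      assume "\<not> l0 \<le> l"
      then have "0 < D (Suc e) l0" using pos[of l0] l0(1) by simp
      then show False using D_Suc[of l0] l0(1,2) s by (auto simp: of_bool_def split: if_splits)
    qed
    then have "row_count w e (k - 1) + 2 \<le> row_count w e l0"
      using gap anti by (meson le_trans)
    then have "\<exists>a. movable v w a (k - 1) e"
      using IH[of l0 "k - 1"] l0 addable_s s l by auto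
    then show ?thesis using no_move s by auto
  next
    case addable: True
    show ?thesis
    proof (cases "0 < D e k")
      case False
      then have *: "w e < k" "k \<le> v e"
        using posk D_Suc[of k] by (auto simp: of_bool_def split: if_splits)
      have "0 < D (Suc e) c" if "w e < c" "c \<le> k" for c
        using that * D_Suc[of c] D_nonneg[of e c] Suc.prems(2) by auto
      then show ?thesis using start * addable by blast
    next
      case True
      then obtain l0 where l0: "l0 < k" "D e l0 \<le> 0" "\<And>c. l0 < c \<Longrightarrow> c \<le> k \<Longrightarrow> 0 < D e c"
        using last_coincidence_below[of v e k w] D_iff D_iff' by metis
      show ?thesis
      proof (cases "row_count w e k + 2 \<le> row_count w e l0")
        case True
        then obtain a where a: "movable v w a k e"
          using IH[of l0 k] l0 addable by blast
        have posa: "0 < D e c" if "w a < c" "c \<le> k" for c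
          using a that D_iff unfolding movable_def by blast
        have "w e \<noteq> k" using no_move a by auto
        then consider "w a \<le> w e" "w e < k" | "\<not> (w a \<le> w e \<and> w e \<le> k)" by linarith
        then show ?thesis
        proof cases
          case 1
          have "0 < D (Suc e) c" if "w e < c" "c \<le> k" for c
            using that 1 D_Suc[of c] posa[of c] by auto
          then show ?thesis using start 1 addable by blast
        next
          case 2
          have "0 < D (Suc e) c" if c: "w a < c" "c \<le> k" for c
          proof (rule ccontr)
            assume "\<not> 0 < D (Suc e) c"
            then have drop: "v e < c" "c \<le> w e"
              using posa[OF c] D_Suc[of c] by (auto simp: of_bool_def split: if_splits)
            then have "k < w e" using 2 c by linarith
            \<comment> \<open>Below \<open>k\<close>, up to row \<open>w e\<close>, the difference drops as well, so it was positive.\<close>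
            have "0 < D e c'" if "l0 < c'" "c' \<le> w e" for c'
            proof (cases "c' \<le> k")
              case False
              then show ?thesis
                using D_Suc[of c'] D_nonneg[of "Suc e" c'] Suc.prems(2) drop c that
                by (auto simp: of_bool_def split: if_splits)
            qed (use that l0 in auto)
            moreover have "row_count w e (w e) + 2 \<le> row_count w e l0"
              using True anti[of k "w e"] \<open>k < w e\<close> by simp
            ultimately have "\<exists>a. movable v w a (w e) e"
              using IH[of l0 "w e"] l0 addable_s \<open>k < w e\<close> by auto
            then show False using no_move by blast
          qed
          then have "movable v w a k (Suc e)"
            using movable_extend[OF a 2] D_iff by blast
          then show ?thesis ..
        qed
      next
        \<comment> \<open>Rows \<open>l0, \<dots>, k - 1\<close> all have one box more than row \<open>k\<close>, so the drop of two at the new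
          time comes from the letter \<open>w e\<close>: it is \<open>l\<close>, or it has moved the lower end of the interval.\<close>
        case False
        then have flat: "row_count w e j \<le> row_count w e k + 1" if "l0 \<le> j" for j
          using anti[OF that] by linarith
        have "l0 \<le> k - 1" using l0(1) by simp
        have "w e \<noteq> k"
          using flat[of "k - 1"] \<open>l0 \<le> k - 1\<close> Suc.prems(6) by (auto simp: row_count_Suc of_bool_def split: if_splits)
        then have gap: "row_count w e k + 2 \<le> row_count w (Suc e) l"
          using Suc.prems(7) by (simp add: row_count_Suc)
        show ?thesis
        proof (cases "l < l0")
          case False
          then have "w e = l" using gap flat[of l] by (auto simp: row_count_Suc of_bool_def split: if_splits)
          then show ?thesis using start addable pos Suc.prems(3) by blast
        next
          case True
          then have *: "w e < l0" "l0 \<le> v e"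
            using pos[of l0] l0(1,2) D_Suc[of l0] by (auto simp: of_bool_def split: if_splits)
          have "0 < D (Suc e) c" if c: "w e < c" "c \<le> k" for c
          proof (cases "c \<le> l0")
            case True
            then show ?thesis using D_Suc[of c] D_nonneg[of e c] Suc.prems(2) * c by auto
          next
            case False
            then show ?thesis using D_Suc[of c] l0(3)[of c] c by auto
          qed
          then show ?thesis using start addable * l0(1) by auto
        qed
      qed
    qed
  qed
qed

text \<open>
  The difference increases from \<open>l\<close> to \<open>l + 1\<close> and decreases from \<open>h\<close> to \<open>h + 1\<close>. So row \<open>l\<close> of \<open>w\<close> is
  longer than row \<open>l\<close> of \<open>v\<close>, while row \<open>h\<close> of \<open>w\<close> is shorter than row \<open>h\<close> of \<open>v\<close>.
\<close>

lemma row_gap_of_interval: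
  assumes "lattice_word r v" "e \<le> r" "l \<le> h"
    and "top_count w e l \<le> top_count v e l" "top_count v e (Suc l) < top_count w e (Suc l)"
    and "top_count v e h < top_count w e h" "top_count w e (Suc h) \<le> top_count v e (Suc h)"
  shows "row_count w e h + 2 \<le> row_count w e l"
  using assms lattice_word_antimono[OF assms(1-3)] by (simp add: top_count_Suc_row)

lemma exists_movable:
  assumes v: "lattice_word r v" and w: "lattice_word r w" and le: "word_le r v w"
    and "x < r" "v x \<noteq> w x"
  shows "\<exists>a k b. b \<le> r \<and> (b < r \<longrightarrow> w b = k) \<and> movable v w a k b"
proof (rule ccontr)
  assume none: "\<not> ?thesis"
  have stuck: "\<not> movable v w a (w e) e" if "e < r" for a e
    using none that less_imp_le by blast
  let ?gap = "\<lambda>e. e \<le> r \<and> (\<exists>c. top_count v e c < top_count w e c)"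
  have "\<exists>e. ?gap e"
  proof (rule ccontr)
    assume "\<nexists>e. ?gap e"
    then have "top_count v e c = top_count w e c" if "e \<le> r" for e c
      using le that unfolding word_le_def by (meson le_antisym not_le)
    then show False using top_count_determines assms(4,5) by blast
  qed
  define e where "e = Greatest ?gap"
  have gap: "?gap e"
    unfolding e_def by (rule GreatestI_ex_nat[OF \<open>\<exists>e. ?gap e\<close>]) auto
  have last: "\<not> ?gap e'" if "e < e'" for e'
    using that Greatest_le_nat[of ?gap e' r] unfolding e_def by auto
  from gap obtain c where c: "e \<le> r" "top_count v e c < top_count w e c" by blast
  have key: "\<exists>a. movable v w a k e"
    if "l < k" "top_count w e l \<le> top_count v e l"
      "\<And>c. l < c \<Longrightarrow> c \<le> k \<Longrightarrow> top_count v e c < top_count w e c"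
      "row_count w e k < row_count w e (k - 1)" "row_count w e k + 2 \<le> row_count w e l" for l k
    by (rule movable_exists[OF w le _ c(1) that(1)]) (use that stuck c(1) in auto)
  show False
  proof (cases "e = r")
    case True
    obtain l where l: "l < c" "top_count w e l \<le> top_count v e l"
      "\<And>d. l < d \<Longrightarrow> d \<le> c \<Longrightarrow> top_count v e d < top_count w e d"
      using last_coincidence_below[OF c(2)] by blast
    let ?end = "\<lambda>h. c \<le> h \<and> top_count w e (Suc h) \<le> top_count v e (Suc h)"
    define h where "h = Least ?end"
    have "?end (c + r)"
      using top_count_le[of w e "Suc (c + r)"] top_count_all_rows[OF v c(1), of "Suc (c + r)"] c(1)
      by simp
    then have h: "?end h" unfolding h_def by (rule LeastI)
    have lower: "top_count v e d < top_count w e d" if "l < d" "d \<le> h" for d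
    proof (cases "d \<le> c")
      case False
      then have "\<not> ?end (d - 1)"
        using not_less_Least[of "d - 1" ?end] that(2) unfolding h_def by simp
      then show ?thesis using False by (auto simp: Suc_diff_1)
    qed (use l that in auto)
    have gap2: "row_count w e h + 2 \<le> row_count w e l"
      by (rule row_gap_of_interval[OF v c(1)]) (use l h lower in auto)
    \<comment> \<open>Row \<open>h\<close> itself need not be able to receive a box; the first row of its length is.\<close>
    let ?short = "\<lambda>k. row_count w e k \<le> row_count w e h"
    define k where "k = Least ?short"
    have k: "?short k" unfolding k_def by (rule LeastI[of ?short h]) simp
    have "k \<le> h" unfolding k_def by (rule Least_le) simp
    have before: "\<not> ?short j" if "j < k" for j
      using that not_less_Least[of j ?short] unfolding k_def by simp
    have "l < k"
    proof (rule ccontr)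
      assume "\<not> l < k"
      then show False
        using lattice_word_antimono[OF w c(1), of k l] k gap2 by simp
    qed
    have "row_count w e k < row_count w e (k - 1)"
      using before[of "k - 1"] k \<open>l < k\<close> by simp
    then obtain a where "movable v w a k e"
      using key[of l k] \<open>l < k\<close> \<open>k \<le> h\<close> l(2) lower k gap2 by auto
    then show False using none True by auto
  next
    \<comment> \<open>All differences vanish in one step, so they are 1 exactly on \<open>v e + 1, \<dots>, w e\<close>.\<close>
    case False
    then have "e < r" using c(1) by simp
    have nogap: "top_count w (Suc e) d \<le> top_count v (Suc e) d" for d
      using last[of "Suc e"] \<open>e < r\<close> by (auto simp: not_less)
    have vw: "v e < d \<and> d \<le> w e \<longleftrightarrow> top_count v e d < top_count w e d" for d
    proof -
      have "top_count v e d \<le> top_count w e d" "top_count v (Suc e) d \<le> top_count w (Suc e) d"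
        using le \<open>e < r\<close> by (simp_all add: word_le_def)
      then show ?thesis using nogap[of d] by (auto simp: top_count_Suc of_bool_def split: if_splits)
    qed
    have "v e < w e" using vw[of c] c(2) by simp
    have edge: "top_count w e (v e) \<le> top_count v e (v e)"
      "top_count w e (Suc (w e)) \<le> top_count v e (Suc (w e))"
      using vw[of "v e"] vw[of "Suc (w e)"] by linarith+
    have inside: "top_count v e d < top_count w e d" if "v e < d" "d \<le> w e" for d
      using vw[of d] that by blast
    have gap2: "row_count w e (w e) + 2 \<le> row_count w e (v e)"
      by (rule row_gap_of_interval[OF v c(1)]) (use \<open>v e < w e\<close> edge inside in auto)
    have "row_count w e (w e) < row_count w e (w e - 1)"
      by (rule lattice_word_addable[OF w \<open>e < r\<close>]) (use \<open>v e < w e\<close> in simp)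
    then have "\<exists>a. movable v w a (w e) e"
      using key[OF \<open>v e < w e\<close> edge(1) inside _ gap2] by blast
    then show False using stuck \<open>e < r\<close> by blast
  qed
qed

section \<open>Tableaux as lattice words\<close>

text \<open>The entry \<open>Suc x\<close> occupies the first free cell of its row.\<close>

definition cell_of :: "(nat \<Rightarrow> nat) \<Rightarrow> nat \<Rightarrow> cell" where
  "cell_of w x = (w x, row_count w x (w x))"

definition tableau_of_word :: "nat \<Rightarrow> (nat \<Rightarrow> nat) \<Rightarrow> tableau \<Rightarrow> bool" where
  "tableau_of_word r w T \<longleftrightarrow> (\<forall>p y. T p = Some y \<longleftrightarrow> (\<exists>x<r. y = Suc x \<and> p = cell_of w x))"

definition reading_word :: "tableau \<Rightarrow> nat \<Rightarrow> nat" where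
  "reading_word T x = (THE i. \<exists>j. T (i, j) = Some (Suc x))"

lemma cell_of_inj: "cell_of w x = cell_of w y \<Longrightarrow> x = y"
  unfolding cell_of_def by (metis Pair_inject row_count_inj)

lemma tableau_of_word_cell: "tableau_of_word r w T \<Longrightarrow> x < r \<Longrightarrow> T (cell_of w x) = Some (Suc x)"
  unfolding tableau_of_word_def by blast

lemma tableau_of_word_reading_word:
  assumes "tableau_of_word r w T" "x < r"
  shows "reading_word T x = w x"
  unfolding reading_word_def
proof (rule the_equality)
  show "\<exists>j. T (w x, j) = Some (Suc x)"
    using tableau_of_word_cell[OF assms] unfolding cell_of_def by blast
  show "i = w x" if "\<exists>j. T (i, j) = Some (Suc x)" for i
    using that assms(1) unfolding tableau_of_word_def cell_of_def by auto
qed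

lemma card_young_diagram: "card (young_diagram \<alpha>) = sum_list \<alpha>"
proof -
  have "young_diagram \<alpha> = (\<lambda>(j, i). (i, j)) ` (SIGMA j:{..<length \<alpha>}. {..<\<alpha> ! j})"
    by (auto simp: young_diagram_def image_def)
  moreover have "inj_on (\<lambda>(j, i). (i, j)) (SIGMA j:{..<length \<alpha>}. {..<\<alpha> ! j})"
    by (auto simp: inj_on_def)
  ultimately have "card (young_diagram \<alpha>) = card (SIGMA j:{..<length \<alpha>}. {..<\<alpha> ! j})"
    by (metis card_image)
  also have "\<dots> = sum_list \<alpha>"
    by (simp add: sum_list_sum_nth atLeast0LessThan)
  finally show ?thesis .
qed

text \<open>
  Rows increase because each new entry is put at the end of its row. Columns increase because
  the lattice condition makes row \<open>i\<close> reach column \<open>j\<close> before any row \<open>i' > i\<close> does.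
\<close>

lemma tableau_of_word_SYTs:
  assumes w: "lattice_word r w" and T: "tableau_of_word r w T"
  shows "T \<in> SYTs r"
proof -
  have dom: "(i, j) \<in> dom T \<longleftrightarrow> j < row_count w r i" for i j
  proof
    assume "(i, j) \<in> dom T"
    then obtain x where "x < r" "(i, j) = cell_of w x"
      using T unfolding tableau_of_word_def by blast
    then show "j < row_count w r i" using row_count_less by (auto simp: cell_of_def)
  next
    assume "j < row_count w r i"
    then obtain x where "x < r" "cell_of w x = (i, j)"
      using row_count_attained by (force simp: cell_of_def)
    then show "(i, j) \<in> dom T" using tableau_of_word_cell[OF T, of x] by auto
  qed
  have dom_image: "dom T = cell_of w ` {..<r}"
    using T unfolding tableau_of_word_def dom_def image_def by blast
  have "(i', j') \<in> dom T" if "(i, j) \<in> dom T" "i' \<le> i" "j' \<le> j" for i j i' j'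
    using that lattice_word_antimono[OF w, of r i' i] unfolding dom by linarith
  then obtain \<alpha> where \<alpha>: "is_partition \<alpha>" "young_diagram \<alpha> = dom T"
    using down_set_is_young_diagram[of "dom T"] dom_image by auto
  have inj: "inj_on (cell_of w) {..<r}"
    using cell_of_inj by (auto simp: inj_on_def)
  have "sum_list \<alpha> = r"
    using card_young_diagram[of \<alpha>] \<alpha>(2) card_image[OF inj] dom_image by simp
  moreover have "bij_betw (\<lambda>p. the (T p)) (dom T) {1..r}"
    unfolding bij_betw_def
  proof
    have ex: "\<exists>x<r. p = cell_of w x \<and> the (T p) = Suc x" if "p \<in> dom T" for p
      using that tableau_of_word_cell[OF T] dom_image by auto
    show "inj_on (\<lambda>p. the (T p)) (dom T)"
      by (rule inj_onI) (metis ex nat.inject)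
    have "(\<lambda>p. the (T p)) ` dom T = Suc ` {..<r}"
      unfolding dom_image image_image using tableau_of_word_cell[OF T] by (auto simp: image_def)
    also have "\<dots> = {1..r}"
      by (simp add: image_Suc_lessThan)
    finally show "(\<lambda>p. the (T p)) ` dom T = {1..r}" .
  qed
  moreover have "the (T (i, j)) < the (T (i, j'))"
    if "j < j'" "(i, j) \<in> dom T" "(i, j') \<in> dom T" for i j j'
  proof -
    from that dom_image obtain x y where xy: "x < r" "(i, j) = cell_of w x" "y < r" "(i, j') = cell_of w y"
      by auto
    then have "x < y"
      using that(1) row_count_mono[of y x w i] by (auto simp: cell_of_def not_less[symmetric])
    then show ?thesis using xy tableau_of_word_cell[OF T] by auto
  qed
  moreover have "the (T (i, j)) < the (T (i', j))"
    if "i < i'" "(i, j) \<in> dom T" "(i', j) \<in> dom T" for i i' j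
  proof -
    from that dom_image obtain x y where xy: "x < r" "(i, j) = cell_of w x" "y < r" "(i', j) = cell_of w y"
      by auto
    have "x < y"
    proof (rule ccontr)
      assume "\<not> x < y"
      then have "y < x" using xy that(1) by (cases "x = y") (auto simp: cell_of_def)
      then have "row_count w (Suc y) i \<le> row_count w x i" by (intro row_count_mono) simp
      moreover have "row_count w (Suc y) i' \<le> row_count w (Suc y) i"
        using lattice_word_antimono[OF w, of "Suc y" i i'] xy that(1) by simp
      ultimately show False using xy by (auto simp: cell_of_def row_count_Suc)
    qed
    then show ?thesis using xy tableau_of_word_cell[OF T] by auto
  qed
  ultimately have "is_SYT \<alpha> T"
    unfolding is_SYT_def \<alpha>(2) by auto
  then show ?thesis using \<alpha>(1) \<open>sum_list \<alpha> = r\<close> unfolding SYTs_def SYT_of_def by auto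
qed

text \<open>
  The entries \<open>\<le> e\<close> form a Young diagram. Its rows have weakly decreasing lengths, which is the
  lattice condition. The cells of row \<open>i\<close> with entries \<open>\<le> x\<close> are those to the left of the cell that
  contains \<open>Suc x\<close>, so counting them recovers the column of this cell.
\<close>

lemma SYTs_reading_word:
  assumes T: "T \<in> SYTs r"
  shows row_count_reading_word:
      "\<And>e i. e \<le> r \<Longrightarrow> row_count (reading_word T) e i = card {j. (i, j) \<in> cells_upto T e}"
    and lattice_reading_word: "lattice_word r (reading_word T)"
    and tableau_of_reading_word: "tableau_of_word r (reading_word T) T"
proof -
  let ?w = "reading_word T"
  from T obtain \<alpha> where \<alpha>: "is_partition \<alpha>" "is_SYT \<alpha> T" "sum_list \<alpha> = r"
    by (auto simp: SYTs_def SYT_of_def)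
  have dom: "dom T = young_diagram \<alpha>" and bij: "bij_betw (\<lambda>p. the (T p)) (dom T) {1..r}"
    and incr: "\<And>i j j'. j < j' \<Longrightarrow> (i, j) \<in> dom T \<Longrightarrow> (i, j') \<in> dom T \<Longrightarrow>
      the (T (i, j)) < the (T (i, j'))"
    using \<alpha>(2,3) unfolding is_SYT_def by auto
  have inj: "p = q" if "T p = Some y" "T q = Some y" for p q y
    using inj_onD[OF bij_betw_imp_inj_on[OF bij], of p q] that by (simp add: domI)
  have range: "\<exists>x<r. y = Suc x" if "T p = Some y" for p y
  proof -
    have "y \<in> {1..r}" using bspec[OF bij_betwE[OF bij] domI[of T, OF that]] that by simp
    then show ?thesis by (intro exI[of _ "y - 1"]) auto
  qed
  have onto: "\<exists>p. T p = Some (Suc x)" if "x < r" for x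
  proof -
    have "Suc x \<in> (\<lambda>p. the (T p)) ` dom T" using bij_betw_imp_surj_on[OF bij] that by auto
    then show ?thesis by force
  qed
  have w_eq: "?w x = i" if "T (i, j) = Some (Suc x)" for i j x
    unfolding reading_word_def using that by (auto dest: inj)
  have fin: "finite {j. (i, j) \<in> cells_upto T e}" for i e
  proof (rule finite_subset)
    show "{j. (i, j) \<in> cells_upto T e} \<subseteq> snd ` young_diagram \<alpha>"
      by (force simp: cells_upto_def dom)
  qed (simp add: finite_young_diagram)
  have down: "(i', j') \<in> cells_upto T e" if "(i, j) \<in> cells_upto T e" "i' \<le> i" "j' \<le> j" for i j i' j' e
    using young_diagram_down[OF subshape(1)[OF T, of e], of i j i' j'] that
    by (simp add: subshape(2)[OF T])
  show count: "row_count ?w e i = card {j. (i, j) \<in> cells_upto T e}" if "e \<le> r" for e i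
  proof -
    have "bij_betw (\<lambda>j. the (T (i, j)) - 1) {j. (i, j) \<in> cells_upto T e} {x. x < e \<and> ?w x = i}"
    proof (rule bij_betwI')
      fix j j' assume "j \<in> {j. (i, j) \<in> cells_upto T e}" "j' \<in> {j. (i, j) \<in> cells_upto T e}"
      then obtain y y' where y: "T (i, j) = Some y" "T (i, j') = Some y'"
        by (auto simp: cells_upto_def)
      obtain x x' where "y = Suc x" "y' = Suc x'" using range[OF y(1)] range[OF y(2)] by blast
      then show "(the (T (i, j)) - 1 = the (T (i, j')) - 1) = (j = j')"
        using y inj[of "(i, j)" y "(i, j')"] by auto
    next
      fix j assume "j \<in> {j. (i, j) \<in> cells_upto T e}"
      then obtain y where y: "T (i, j) = Some y" "y \<le> e"
        by (auto simp: cells_upto_def)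
      obtain x where "y = Suc x" using range[OF y(1)] by blast
      then show "the (T (i, j)) - 1 \<in> {x. x < e \<and> ?w x = i}"
        using y w_eq by simp
    next
      fix x assume x: "x \<in> {x. x < e \<and> ?w x = i}"
      then have "x < r" using that by simp
      obtain i' j where j: "T (i', j) = Some (Suc x)" using onto[OF \<open>x < r\<close>] by (metis surj_pair)
      then have "i' = i" using w_eq[OF j] x by simp
      then have "(i, j) \<in> cells_upto T e" "x = the (T (i, j)) - 1"
        using j x by (simp_all add: cells_upto_def domI)
      then show "\<exists>j\<in>{j. (i, j) \<in> cells_upto T e}. x = the (T (i, j)) - 1" by blast
    qed
    then show ?thesis unfolding row_count_def by (simp add: bij_betw_same_card)
  qed
  show "lattice_word r ?w"
    unfolding lattice_word_def
  proof (intro allI impI)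
    fix e i assume e: "e \<le> r"
    show "row_count ?w e (Suc i) \<le> row_count ?w e i"
      unfolding count[OF e] by (rule card_mono[OF fin]) (use down in auto)
  qed
  have cell: "(i, j) = cell_of ?w x" if "x < r" "T (i, j) = Some (Suc x)" for i j x
  proof -
    have "(i, j') \<in> cells_upto T x \<longleftrightarrow> j' < j" for j'
    proof
      assume "(i, j') \<in> cells_upto T x"
      then show "j' < j"
        using incr[of j j' i] that(2) by (cases j' j rule: linorder_cases) (auto simp: cells_upto_def)
    next
      assume j': "j' < j"
      have "(i, j) \<in> cells_upto T (Suc x)" using that(2) by (auto simp: cells_upto_def)
      then have "(i, j') \<in> dom T" using down[of i j "Suc x" i j'] j' by (auto simp: cells_upto_def)
      then show "(i, j') \<in> cells_upto T x"
        using incr[OF j', of i] domI[of T, OF that(2)] that(2) by (simp add: cells_upto_def)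
    qed
    then have "row_count ?w x i = card {..<j}"
      using count[of x i] that(1) by (simp add: lessThan_def)
    then show ?thesis using w_eq[OF that(2)] by (simp add: cell_of_def)
  qed
  show "tableau_of_word r ?w T"
    unfolding tableau_of_word_def
  proof (intro allI iffI)
    fix p y assume y: "T p = Some y"
    then show "\<exists>x<r. y = Suc x \<and> p = cell_of ?w x"
      using range[OF y] cell by (cases p) auto
  next
    fix p y assume "\<exists>x<r. y = Suc x \<and> p = cell_of ?w x"
    then obtain x where x: "x < r" "y = Suc x" "p = cell_of ?w x" by blast
    obtain q where "T q = Some (Suc x)" using onto[OF x(1)] by blast
    then show "T p = Some y" using x cell by (cases q) auto
  qed
qed

lemma sum_transposed_part_subshape:
  assumes "T \<in> SYTs r" "e \<le> r"
  shows "(\<Sum>i=1..c. transposed_part (subshape T e) i) = top_count (reading_word T) e c"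
proof -
  have "transposed_part (subshape T e) (Suc i) = row_count (reading_word T) e i" for i
    using card_row_young_diagram[of i "subshape T e"] subshape(2)[OF assms(1)]
      row_count_reading_word[OF assms] by simp
  then show ?thesis
    by (simp add: sum.atLeast1_atMost_eq top_count_eq_sum)
qed

lemma dom_le_iff_word_le:
  assumes "P \<in> SYTs r" "S \<in> SYTs r"
  shows "dom_le r P S \<longleftrightarrow> word_le r (reading_word P) (reading_word S)"
proof -
  have "dom_le r P S \<longleftrightarrow>
    (\<forall>e\<in>{1..r}. \<forall>c. top_count (reading_word P) e c \<le> top_count (reading_word S) e c)"
    using assms by (auto simp: dom_le_def nat_le_def sum_transposed_part_subshape simp del: One_nat_def)
  also have "\<dots> \<longleftrightarrow> word_le r (reading_word P) (reading_word S)"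
    unfolding word_le_def by (metis Suc_leI One_nat_def atLeastAtMost_iff le_refl neq0_conv top_count_0)
  finally show ?thesis .
qed

lemma row_length_eq_row_count:
  assumes "T \<in> SYTs r"
  shows "row_length T i = row_count (reading_word T) r i"
proof -
  have "the (T p) \<le> r" if p: "p \<in> dom T" for p
  proof -
    obtain y where y: "T p = Some y" using p by blast
    then obtain x where "x < r" "y = Suc x"
      using tableau_of_reading_word[OF assms] unfolding tableau_of_word_def by blast
    then show ?thesis using y by simp
  qed
  then have "cells_upto T r = dom T"
    unfolding cells_upto_def by blast
  then show ?thesis
    using row_count_reading_word[OF assms] by (simp add: row_length_def)
qed

lemma tableau_eqI:
  assumes "P \<in> SYTs r" "S \<in> SYTs r" "\<And>x. x < r \<Longrightarrow> reading_word P x = reading_word S x"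
  shows "P = S"
proof -
  have "row_count (reading_word P) x i = row_count (reading_word S) x i" if "x < r" for x i
  proof -
    have "{y. y < x \<and> reading_word P y = i} = {y. y < x \<and> reading_word S y = i}"
      using assms(3) that by auto
    then show ?thesis by (simp add: row_count_def)
  qed
  then have "cell_of (reading_word P) x = cell_of (reading_word S) x" if "x < r" for x
    using assms(3) that by (simp add: cell_of_def)
  then have "P p = Some y \<longleftrightarrow> S p = Some y" for p y
    using tableau_of_reading_word[OF assms(1)] tableau_of_reading_word[OF assms(2)]
    unfolding tableau_of_word_def by metis
  then show ?thesis by (metis ext not_Some_eq)
qed

section \<open>Box moves as exchanges of letters\<close>

lemma reading_word_eqI:
  assumes "T \<in> SYTs r" "T (i, j) = Some (Suc x)"
  shows "reading_word T x = i"
  using tableau_of_reading_word[OF assms(1)] assms(2)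
  unfolding tableau_of_word_def by (metis Pair_inject cell_of_def nat.inject)

text \<open>
  A shift is described by the exchange with the position \<open>b = r\<close> behind the word.
\<close>

lemma box_move_exchange:
  assumes "box_move r S P"
  obtains a b k where "a < b" "b \<le> r" "reading_word S a < k" "b < r \<Longrightarrow> reading_word S b = k"
    "\<And>x. x < r \<Longrightarrow> reading_word P x = ((reading_word S)(a := k, b := reading_word S a)) x"
proof -
  let ?w = "reading_word S"
  have S: "S \<in> SYTs r" and P: "P \<in> SYTs r" and move: "swap_move S P \<or> shift_move S P"
    using assms by (auto simp: box_move_def)
  note wS = tableau_of_reading_word[OF S]
  have read: "\<exists>x<r. y = Suc x \<and> p = cell_of ?w x" if "S p = Some y" for p y
    using wS that unfolding tableau_of_word_def by blast
  have keep: "reading_word P x = ?w x" if "x < r" "P (cell_of ?w x) = S (cell_of ?w x)" for x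
    using reading_word_eqI[OF P] that tableau_of_word_cell[OF wS that(1)] by (simp add: cell_of_def)
  from move show ?thesis
  proof
    assume "swap_move S P"
    then obtain i j k l a' b' where ab: "S (i, j) = Some a'" "S (k, l) = Some b'" "a' < b'" "i < k"
      and P_def: "P = S((i, j) \<mapsto> b', (k, l) \<mapsto> a')"
      unfolding swap_move_def by blast
    obtain a b where a: "a < r" "a' = Suc a" "(i, j) = cell_of ?w a"
      and b: "b < r" "b' = Suc b" "(k, l) = cell_of ?w b"
      using read[OF ab(1)] read[OF ab(2)] by blast
    show ?thesis
    proof (rule that[of a b k])
      fix x assume x: "x < r"
      have w: "?w a = i" "?w b = k" using a b by (auto simp: cell_of_def)
      have "reading_word P a = k"
        by (rule reading_word_eqI[OF P, of k l]) (simp add: P_def a(2))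
      moreover have "reading_word P b = i"
        by (rule reading_word_eqI[OF P, of i j]) (use ab(4) in \<open>simp add: P_def b(2)\<close>)
      moreover have "reading_word P x = ?w x" if "x \<noteq> a" "x \<noteq> b"
        by (rule keep[OF x]) (use that a b cell_of_inj in \<open>auto simp: P_def\<close>)
      ultimately show "reading_word P x = (?w(a := k, b := ?w a)) x"
        using w by auto
    qed (use ab a b in \<open>auto simp: cell_of_def\<close>)
  next
    assume "shift_move S P"
    then obtain i k where i: "0 < row_length S i" "i < k"
      and P_def: "P = S((i, row_length S i - 1) := None,
              (k, row_length S k) := S (i, row_length S i - 1))"
      unfolding shift_move_def by blast
    obtain a where a: "a < r" "cell_of ?w a = (i, row_length S i - 1)"
      using row_count_attained[of "row_length S i - 1" ?w r i] i(1)
      unfolding row_length_eq_row_count[OF S] by (auto simp: cell_of_def)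
    show ?thesis
    proof (rule that[of a r k])
      fix x assume x: "x < r"
      have "reading_word P a = k"
        by (rule reading_word_eqI[OF P, of k "row_length S k"])
          (use tableau_of_word_cell[OF wS a(1)] a(2) in \<open>simp add: P_def\<close>)
      moreover have "reading_word P x = ?w x" if "x \<noteq> a"
      proof (rule keep[OF x])
        have "cell_of ?w x \<noteq> (k, row_length S k)"
          using row_count_less[of ?w x k r] x unfolding row_length_eq_row_count[OF S]
          by (auto simp: cell_of_def)
        moreover have "cell_of ?w x \<noteq> (i, row_length S i - 1)"
          using that a(2) cell_of_inj by metis
        ultimately show "P (cell_of ?w x) = S (cell_of ?w x)" by (simp add: P_def)
      qed
      ultimately show "reading_word P x = (?w(a := k, r := ?w a)) x"
        using x by auto
    qed (use a i in \<open>auto simp: cell_of_def\<close>)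
  qed
qed

lemma box_move_word_le:
  assumes "box_move r S P"
  shows "word_le r (reading_word P) (reading_word S)"
  unfolding word_le_def
proof (intro allI impI)
  fix e c assume e: "e \<le> r"
  let ?w = "reading_word S"
  obtain a b k where ab: "a < b" "b \<le> r" "?w a < k" "b < r \<Longrightarrow> ?w b = k"
    and P: "\<And>x. x < r \<Longrightarrow> reading_word P x = (?w(a := k, b := ?w a)) x"
    using box_move_exchange[OF assms] by metis
  have "e \<le> b \<or> ?w b = k"
    using ab(2,4) e by (meson le_trans not_le)
  from top_count_exchange[OF ab(1) refl ab(3) this, of c]
    top_count_cong[of r "reading_word P" "?w(a := k, b := ?w a)", OF P e, of c]
  show "top_count (reading_word P) e c \<le> top_count ?w e c" by linarith
qed

text \<open>
  Since no letter \<open>w a\<close> or \<open>k\<close> occurs between \<open>a\<close> and \<open>b\<close>, all the other entries keep their cells when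
  the tableau is built from the new word. The entry \<open>Suc a\<close> takes the cell of \<open>Suc b\<close> and vice
  versa; if \<open>b = r\<close>, it takes the first free cell of row \<open>k\<close> and leaves the end of its row.
\<close>

lemma exchange_box_move:
  assumes S: "S \<in> SYTs r" and "b \<le> r" "b < r \<Longrightarrow> reading_word S b = k"
    and mov: "movable v (reading_word S) a k b"
  shows "\<exists>P. box_move r S P \<and>
    (\<forall>x<r. reading_word P x = ((reading_word S)(a := k, b := reading_word S a)) x)"
proof -
  define w where "w = reading_word S"
  define w' where "w' = w(a := k, b := w a)"
  have ab: "a < b" "w a < k" and between: "\<And>u. a < u \<Longrightarrow> u < b \<Longrightarrow> \<not> (w a \<le> w u \<and> w u \<le> k)"
    and addable: "row_count w a k < row_count w a (k - 1)"
    using mov unfolding movable_def w_def by simp_all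
  have b: "b \<le> r" "b < r \<Longrightarrow> w b = k" using assms(2,3) by (auto simp: w_def)
  have wS: "tableau_of_word r w S" "lattice_word r w"
    unfolding w_def by (rule tableau_of_reading_word[OF S], rule lattice_reading_word[OF S])
  have w'_simps: "w' a = k" "w' b = w a" "\<And>x. x \<noteq> a \<Longrightarrow> x \<noteq> b \<Longrightarrow> w' x = w x"
    using ab by (auto simp: w'_def)
  have exch: "row_count w' e j + of_bool (a < e \<and> e \<le> b \<and> j = w a)
       = row_count w e j + of_bool (a < e \<and> e \<le> b \<and> j = k)" if "e \<le> r" for e j
    unfolding w'_def
  proof (rule row_count_exchange[OF ab(1) refl])
    show "e \<le> b \<or> w b = k" using b that by (meson le_trans not_le)
  qed
  have const: "row_count w b j = row_count w (Suc a) j" if "j = w a \<or> j = k" for j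
  proof (rule row_count_constant)
    show "w u \<noteq> j" if "Suc a \<le> u" "u < b" for u
      using between[of u] that \<open>j = w a \<or> j = k\<close> ab by auto
  qed (use ab in simp)
  have count_b: "row_count w b (w a) = Suc (row_count w a (w a))" "row_count w b k = row_count w a k"
    using const ab by (auto simp: row_count_Suc)
  have cell_a: "cell_of w' a = (k, row_count w b k)"
    using exch[of a k] ab b count_b by (simp add: cell_of_def w'_simps)
  have cell_b: "cell_of w' b = cell_of w a"
    using exch[of b "w a"] ab b count_b by (simp add: cell_of_def w'_simps)
  have cell_other: "cell_of w' x = cell_of w x" if "x < r" "x \<noteq> a" "x \<noteq> b" for x
    using exch[of x "w x"] between[of x] that ab b
    by (cases "a < x \<and> x < b") (auto simp: cell_of_def w'_simps)
  have Sa: "S (cell_of w a) = Some (Suc a)"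
    using tableau_of_word_cell[OF wS(1)] ab b by simp
  have read: "S p = Some y \<longleftrightarrow> (\<exists>x<r. y = Suc x \<and> p = cell_of w x)" for p y
    using wS(1) unfolding tableau_of_word_def by blast
  have "\<exists>P. (swap_move S P \<or> shift_move S P) \<and> tableau_of_word r w' P"
  proof (cases "b < r")
    case True
    define P where "P = S(cell_of w a \<mapsto> Suc b, cell_of w b \<mapsto> Suc a)"
    have cell_a': "cell_of w' a = cell_of w b"
      unfolding cell_a unfolding cell_of_def b(2)[OF True] by simp
    have ne: "cell_of w a \<noteq> cell_of w b" using cell_of_inj ab by blast
    have "swap_move S P"
      unfolding swap_move_def P_def cell_of_def
      using Sa tableau_of_word_cell[OF wS(1) True] ab b(2)[OF True] unfolding cell_of_def
      by (metis Suc_less_eq)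
    moreover have "tableau_of_word r w' P"
      unfolding tableau_of_word_def
    proof (intro allI)
      fix p y
      consider "p = cell_of w a" | "p = cell_of w b" | "p \<noteq> cell_of w a" "p \<noteq> cell_of w b" by blast
      then show "P p = Some y \<longleftrightarrow> (\<exists>x<r. y = Suc x \<and> p = cell_of w' x)"
      proof cases
        case 1
        then show ?thesis using cell_b ne True cell_of_inj[of w' b] by (auto simp: P_def)
      next
        case 2
        then show ?thesis using cell_a' True ab cell_of_inj[of w' a] by (auto simp: P_def)
      next
        case 3
        then have "P p = S p" by (simp add: P_def)
        then show ?thesis using read[of p y] cell_other cell_a' cell_b 3 by metis
      qed
    qed
    ultimately show ?thesis by blast
  next
    case False
    then have "b = r" using b by simp
    define P where "P = S(cell_of w a := None, cell_of w' a \<mapsto> Suc a)"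
    have len: "row_length S i = row_count w r i" for i
      using row_length_eq_row_count[OF S] by (simp add: w_def)
    have ne: "cell_of w x \<noteq> cell_of w' a" if "x < r" for x
      using row_count_less[of w x k r] that \<open>b = r\<close> unfolding cell_a by (auto simp: cell_of_def)
    have last: "cell_of w a = (w a, row_length S (w a) - 1)"
      using count_b(1) by (simp add: len \<open>b = r\<close> cell_of_def)
    have "P = S((w a, row_length S (w a) - 1) := None,
              (k, row_length S k) := S (w a, row_length S (w a) - 1))"
      using Sa unfolding P_def last cell_a by (simp add: len \<open>b = r\<close>)
    moreover have "0 < row_length S (w a)"
      using count_b(1) by (simp add: len \<open>b = r\<close>)
    ultimately have "shift_move S P" unfolding shift_move_def using ab(2) by blast
    moreover have "tableau_of_word r w' P"
      unfolding tableau_of_word_def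
    proof (intro allI)
      fix p y
      have "a < r" using ab b by simp
      consider "p = cell_of w a" | "p = cell_of w' a" | "p \<noteq> cell_of w a" "p \<noteq> cell_of w' a" by blast
      then show "P p = Some y \<longleftrightarrow> (\<exists>x<r. y = Suc x \<and> p = cell_of w' x)"
      proof cases
        case 1
        then have "P p = None" using ne[OF \<open>a < r\<close>] by (simp add: P_def)
        moreover have "p \<noteq> cell_of w' x" if "x < r" for x
          using cell_of_inj[of w' b x] that 1 cell_b \<open>b = r\<close> by auto
        ultimately show ?thesis by auto
      next
        case 2
        then show ?thesis using \<open>a < r\<close> cell_of_inj[of w' a] by (auto simp: P_def)
      next
        case 3
        then have "P p = S p" by (simp add: P_def)
        then show ?thesis using read[of p y] cell_other 3 \<open>b = r\<close> by (metis less_irrefl)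
      qed
    qed
    ultimately show ?thesis by blast
  qed
  then obtain P where P: "swap_move S P \<or> shift_move S P" "tableau_of_word r w' P" by blast
  have "lattice_word r w'"
    unfolding w'_def by (rule exchange_lattice_word[OF wS(2) ab(1) b(1) ab(2) b(2) between addable])
  then have "P \<in> SYTs r" using tableau_of_word_SYTs P(2) by blast
  then have "box_move r S P" using S P(1) by (simp add: box_move_def)
  moreover have "\<forall>x<r. reading_word P x = w' x"
    using tableau_of_word_reading_word[OF P(2)] by blast
  ultimately show ?thesis unfolding w'_def w_def by blast
qed

text \<open>
  The time \<open>e\<close> and the row bound \<open>c\<close> at which a count drops witness progress in the induction of
  \<open>word_le_imp_box_le\<close>.
\<close>

lemma exists_box_move:
  assumes P: "P \<in> SYTs r" and S: "S \<in> SYTs r" and "P \<noteq> S"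
    and le: "word_le r (reading_word P) (reading_word S)"
  obtains Q e c where "box_move r S Q" "word_le r (reading_word P) (reading_word Q)"
    "e \<le> r" "c \<le> r" "top_count (reading_word Q) e c < top_count (reading_word S) e c"
proof -
  let ?v = "reading_word P" and ?w = "reading_word S"
  obtain x where x: "x < r" "?v x \<noteq> ?w x"
    using tableau_eqI[OF P S] assms(3) by blast
  obtain a k b where b: "b \<le> r" "b < r \<Longrightarrow> ?w b = k" and mov: "movable ?v ?w a k b"
    using exists_movable[OF lattice_reading_word[OF P] lattice_reading_word[OF S] le x] by blast
  obtain Q where Q: "box_move r S Q"
    and word: "\<And>x. x < r \<Longrightarrow> reading_word Q x = (?w(a := k, b := ?w a)) x"
    using exchange_box_move[OF S b mov] by blast
  have ab: "a < b" "?w a < k"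
    and pos: "\<And>u c. a < u \<Longrightarrow> u \<le> b \<Longrightarrow> ?w a < c \<Longrightarrow> c \<le> k \<Longrightarrow> top_count ?v u c < top_count ?w u c"
    using mov unfolding movable_def by simp_all
  have Q_count: "top_count (reading_word Q) e c + of_bool (a < e \<and> e \<le> b \<and> ?w a < c \<and> c \<le> k)
      = top_count ?w e c" if "e \<le> r" for e c
  proof -
    have "e \<le> b \<or> ?w b = k" using b that by (meson le_trans not_le)
    from top_count_exchange[OF ab(1) refl ab(2) this, of c]
      top_count_cong[of r "reading_word Q" "?w(a := k, b := ?w a)", OF word that, of c]
    show ?thesis by simp
  qed
  have "word_le r ?v (reading_word Q)"
    unfolding word_le_def
  proof (intro allI impI)
    fix e c assume e: "e \<le> r"
    show "top_count ?v e c \<le> top_count (reading_word Q) e c"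
      using Q_count[OF e, of c] pos[of e c] le e
      by (cases "a < e \<and> e \<le> b \<and> ?w a < c \<and> c \<le> k") (auto simp: word_le_def)
  qed
  \<comment> \<open>Otherwise the first \<open>k\<close> rows would contain all the entries of both tableaux at time \<open>b\<close>.\<close>
  moreover have "k \<le> r"
  proof (rule ccontr)
    assume "\<not> k \<le> r"
    then have "top_count ?v b k = b"
      by (intro top_count_all_rows[OF lattice_reading_word[OF P]]) (use b in auto)
    then show False using pos[of b k] ab top_count_le[of ?w b k] by simp
  qed
  ultimately show ?thesis
    using that[of Q b k] Q b(1) Q_count[OF b(1), of k] ab by simp
qed

lemma word_le_imp_box_le:
  assumes "P \<in> SYTs r" "S \<in> SYTs r" "word_le r (reading_word P) (reading_word S)"
  shows "box_le r P S"
  using assms(2,3)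
proof (induction "\<Sum>(e, c)\<in>{..r} \<times> {..r}. top_count (reading_word S) e c" arbitrary: S rule: less_induct)
  case less
  show ?case
  proof (cases "P = S")
    case True
    then show ?thesis by (simp add: box_le_def)
  next
    case False
    then obtain Q e c where Q: "box_move r S Q" "word_le r (reading_word P) (reading_word Q)"
      and less_ec: "e \<le> r" "c \<le> r" "top_count (reading_word Q) e c < top_count (reading_word S) e c"
      using exists_box_move[OF assms(1) less.prems(1) False less.prems(2)] by metis
    have "(\<Sum>(e, c)\<in>{..r} \<times> {..r}. top_count (reading_word Q) e c)
        < (\<Sum>(e, c)\<in>{..r} \<times> {..r}. top_count (reading_word S) e c)"
    proof (rule sum_strict_mono_ex1)
      show "\<forall>x\<in>{..r} \<times> {..r}. (case x of (e, c) \<Rightarrow> top_count (reading_word Q) e c)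
          \<le> (case x of (e, c) \<Rightarrow> top_count (reading_word S) e c)"
        using box_move_word_le[OF Q(1)] by (auto simp: word_le_def)
    qed (use less_ec in auto)
    moreover have "Q \<in> SYTs r" using Q(1) by (simp add: box_move_def)
    ultimately have "box_le r P Q" using less.hyps Q(2) by blast
    then show ?thesis
      using Q(1) by (auto simp: box_le_def intro: converse_rtranclp_into_rtranclp)
  qed
qed

lemma box_le_imp_word_le:
  assumes "box_le r P S"
  shows "word_le r (reading_word P) (reading_word S)"
  using assms unfolding box_le_def
proof (induction rule: rtranclp_induct)
  case base
  then show ?case by (simp add: word_le_def)
next
  case (step Q P)
  then show ?case
    using box_move_word_le[OF step.hyps(2)] unfolding word_le_def by (meson le_trans)
qed

theorem theorem1p1:
  fixes r :: nat
  assumes "r \<ge> 1"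
  shows "\<forall>P\<in>SYTs r. \<forall>S\<in>SYTs r. box_le r P S \<longleftrightarrow> dom_le r P S"
  using word_le_imp_box_le box_le_imp_word_le dom_le_iff_word_le by blast

end
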